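(* Let $(S,\bullet)$ be a partial semigroup, let $L$ be a minimal left ideal of $S$, and let $T\subseteq S$ with $\bigcap_{s\in L}(R(s)\cap T)\neq\emptyset$. Then $T$ is a minimal left ideal of $S$ if and only if there is some $a\in\bigcap_{s\in L}(R(s)\cap T)$ such that $T=L\bullet a$.
   Context: A partial semigroup is a nonempty set $S$ with a partially defined operation $\bullet$ such that $(x\bullet y)\bullet z=x\bullet(y\bullet z)$ in the sense that if either side is defined so is the other and they are equal. $R(x)=\{s:x\bullet s\text{ defined}\}$, $L(x)=\{s:s\bullet x\text{ defined}\}$. A left ideal is a nonempty $I\subseteq S$ with $y\bullet x\in I$ whenever $x\in I$ and $y\in L(x)$; minimal if it contains no other left ideal. $L\bullet a=\{s\bullet a:s\in L\}$. *)

theory Defs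
  imports Main
begin

text \<open>A partially defined operation on the carrier \<open>S\<close> is a function
  \<open>mul :: 'a \<Rightarrow> 'a \<Rightarrow> 'a option\<close>, where \<open>None\<close> means ``undefined''; only its values
  on arguments from \<open>S\<close> are relevant. The side \<open>(x \<bullet> y) \<bullet> z\<close> is defined iff \<open>x \<bullet> y\<close> and then
  its product with \<open>z\<close> are defined, so equality of the two \<open>Option.bind\<close> expressions says that
  if one side is defined then so is the other, with the same value.\<close>

definition partial_semigroup :: "'a set \<Rightarrow> ('a \<Rightarrow> 'a \<Rightarrow> 'a option) \<Rightarrow> bool" where
  "partial_semigroup S mul \<longleftrightarrow>
     S \<noteq> {} \<and>
     (\<forall>x\<in>S. \<forall>y\<in>S. \<forall>z. mul x y = Some z \<longrightarrow> z \<in> S) \<and>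
     (\<forall>x\<in>S. \<forall>y\<in>S. \<forall>z\<in>S.
        Option.bind (mul x y) (\<lambda>u. mul u z) = Option.bind (mul y z) (\<lambda>v. mul x v))"

definition right_dom :: "'a set \<Rightarrow> ('a \<Rightarrow> 'a \<Rightarrow> 'a option) \<Rightarrow> 'a \<Rightarrow> 'a set" where
  "right_dom S mul x = {s \<in> S. mul x s \<noteq> None}"

definition left_dom :: "'a set \<Rightarrow> ('a \<Rightarrow> 'a \<Rightarrow> 'a option) \<Rightarrow> 'a \<Rightarrow> 'a set" where
  "left_dom S mul x = {s \<in> S. mul s x \<noteq> None}"

definition left_ideal :: "'a set \<Rightarrow> ('a \<Rightarrow> 'a \<Rightarrow> 'a option) \<Rightarrow> 'a set \<Rightarrow> bool" where
  "left_ideal S mul I \<longleftrightarrow>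
     I \<noteq> {} \<and> I \<subseteq> S \<and> (\<forall>x\<in>I. \<forall>y\<in>left_dom S mul x. the (mul y x) \<in> I)"

definition minimal_left_ideal :: "'a set \<Rightarrow> ('a \<Rightarrow> 'a \<Rightarrow> 'a option) \<Rightarrow> 'a set \<Rightarrow> bool" where
  "minimal_left_ideal S mul I \<longleftrightarrow>
     left_ideal S mul I \<and> (\<forall>J. left_ideal S mul J \<and> J \<subseteq> I \<longrightarrow> J = I)"

definition right_translate :: "('a \<Rightarrow> 'a \<Rightarrow> 'a option) \<Rightarrow> 'a set \<Rightarrow> 'a \<Rightarrow> 'a set" where
  "right_translate mul L a = {z. \<exists>s\<in>L. mul s a = Some z}"

end

theory Submission
  imports Defs
begin

text \<open>If \<open>s \<bullet> a\<close> is defined for all \<open>s \<in> L\<close>, then right translation by \<open>a\<close> carries the minimal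
  left ideal \<open>L\<close> onto a left ideal \<open>L \<bullet> a\<close>, and pulls a left ideal inside \<open>L \<bullet> a\<close> back to a left
  ideal inside \<open>L\<close>, which must be all of \<open>L\<close>; hence \<open>L \<bullet> a\<close> is minimal. Conversely, if \<open>a\<close> lies in
  the minimal left ideal \<open>T\<close>, then \<open>L \<bullet> a\<close> is a left ideal inside \<open>T\<close>.\<close>

lemma partial_semigroup_assoc:
  assumes "partial_semigroup S mul" "x \<in> S" "y \<in> S" "z \<in> S"
  shows "Option.bind (mul x y) (\<lambda>u. mul u z) = Option.bind (mul y z) (\<lambda>v. mul x v)"
  using assms unfolding partial_semigroup_def by blast

lemma partial_semigroup_closed:
  assumes "partial_semigroup S mul" "x \<in> S" "y \<in> S" "mul x y = Some z"
  shows "z \<in> S"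
  using assms unfolding partial_semigroup_def by blast

lemma left_idealI:
  assumes "I \<noteq> {}" "I \<subseteq> S"
    and "\<And>x y z. x \<in> I \<Longrightarrow> y \<in> S \<Longrightarrow> mul y x = Some z \<Longrightarrow> z \<in> I"
  shows "left_ideal S mul I"
  using assms unfolding left_ideal_def left_dom_def by auto

lemma left_ideal_closed:
  assumes "left_ideal S mul I" "x \<in> I" "y \<in> S" "mul y x = Some z"
  shows "z \<in> I"
  using assms unfolding left_ideal_def left_dom_def by force

text \<open>If \<open>y \<bullet> (s \<bullet> a)\<close> is defined, associativity forces
  \<open>y \<bullet> s\<close> to be defined too and gives the value
  \<open>(y \<bullet> s) \<bullet> a\<close>, where \<open>y \<bullet> s\<close> lies in
  \<open>L\<close> again.\<close>

lemma left_ideal_right_translate: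
  assumes sg: "partial_semigroup S mul" and L: "left_ideal S mul L"
    and a: "a \<in> S" "\<And>s. s \<in> L \<Longrightarrow> mul s a \<noteq> None"
  shows "left_ideal S mul (right_translate mul L a)"
proof (rule left_idealI)
  have LS: "L \<subseteq> S" "L \<noteq> {}" using L by (auto simp: left_ideal_def)
  show "right_translate mul L a \<noteq> {}"
    using LS(2) a(2) unfolding right_translate_def by fastforce
  show "right_translate mul L a \<subseteq> S"
    using partial_semigroup_closed[OF sg] LS(1) a(1) unfolding right_translate_def by blast
  fix x y z assume "x \<in> right_translate mul L a" and y: "y \<in> S" and z: "mul y x = Some z"
  then obtain s where s: "s \<in> L" "mul s a = Some x" by (auto simp: right_translate_def)
  have "Option.bind (mul y s) (\<lambda>u. mul u a) = Some z"
    using partial_semigroup_assoc[OF sg y _ a(1)] s z LS(1) by auto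
  then obtain u where "mul y s = Some u" "mul u a = Some z" by (auto simp: bind_eq_Some_conv)
  then show "z \<in> right_translate mul L a"
    using left_ideal_closed[OF L s(1) y] by (auto simp: right_translate_def)
qed

lemma minimal_left_ideal_right_translate:
  assumes sg: "partial_semigroup S mul" and L: "minimal_left_ideal S mul L"
    and a: "a \<in> S" "\<And>s. s \<in> L \<Longrightarrow> mul s a \<noteq> None"
  shows "minimal_left_ideal S mul (right_translate mul L a)"
  unfolding minimal_left_ideal_def
proof (intro conjI allI impI; (elim conjE)?)
  have Lid: "left_ideal S mul L" using L by (simp add: minimal_left_ideal_def)
  then have LS: "L \<subseteq> S" by (simp add: left_ideal_def)
  show "left_ideal S mul (right_translate mul L a)"
    using left_ideal_right_translate[OF sg Lid a] .
  fix J assume J: "left_ideal S mul J" and sub: "J \<subseteq> right_translate mul L a"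
  \<comment> \<open>The preimage of \<open>J\<close> under right translation by \<open>a\<close>. It
    is nonempty because each element of \<open>J\<close> has the form \<open>s \<bullet> a\<close>
    with \<open>s\<close> in \<open>L\<close>.\<close>
  define K where "K = {s \<in> L. \<exists>z\<in>J. mul s a = Some z}"
  have "left_ideal S mul K"
  proof (rule left_idealI)
    show "K \<noteq> {}"
      using J sub by (fastforce simp: K_def left_ideal_def right_translate_def)
    show "K \<subseteq> S" using LS by (auto simp: K_def)
    fix s y u assume "s \<in> K" and y: "y \<in> S" and u: "mul y s = Some u"
    then obtain z where s: "s \<in> L" and z: "z \<in> J" "mul s a = Some z" by (auto simp: K_def)
    have uL: "u \<in> L" using left_ideal_closed[OF Lid s y u] .
    \<comment> \<open>Totality of the translation on \<open>L\<close> is crucial here: as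
      \<open>(y \<bullet> s) \<bullet> a\<close> is defined, so is
      \<open>y \<bullet> (s \<bullet> a)\<close>, and \<open>J\<close> absorbs this value.\<close>
    then obtain w where w: "mul u a = Some w" using a(2) by blast
    have "mul y z = Some w"
      using partial_semigroup_assoc[OF sg y _ a(1), of s] s u z w LS by auto
    then show "u \<in> K"
      using left_ideal_closed[OF J z(1) y] uL w by (auto simp: K_def)
  qed
  moreover have "K \<subseteq> L" by (auto simp: K_def)
  ultimately have "K = L" using L by (simp add: minimal_left_ideal_def)
  then have "\<forall>s\<in>L. \<exists>z\<in>J. mul s a = Some z" by (auto simp: K_def)
  then have "right_translate mul L a \<subseteq> J" by (fastforce simp: right_translate_def)
  with sub show "J = right_translate mul L a" by blast
qed

theorem theorem2p14:
  fixes S L T :: "'a set" and mul :: "'a \<Rightarrow> 'a \<Rightarrow> 'a option"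
  assumes "partial_semigroup S mul"
    and "minimal_left_ideal S mul L"
    and "T \<subseteq> S"
    and "(\<Inter>s\<in>L. right_dom S mul s \<inter> T) \<noteq> {}"
  shows "minimal_left_ideal S mul T \<longleftrightarrow>
    (\<exists>a\<in>(\<Inter>s\<in>L. right_dom S mul s \<inter> T). T = right_translate mul L a)"
proof -
  have L: "left_ideal S mul L" using assms(2) by (simp add: minimal_left_ideal_def)
  then have LS: "L \<noteq> {}" "L \<subseteq> S" by (auto simp: left_ideal_def)
  \<comment> \<open>\<open>L\<close> being nonempty matters: an intersection over an empty index set
    would be the whole type and would not place \<open>a\<close> in \<open>S\<close> or
    \<open>T\<close>.\<close>
  have dom: "a \<in> S \<and> a \<in> T \<and> (\<forall>s\<in>L. mul s a \<noteq> None)"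
    if "a \<in> (\<Inter>s\<in>L. right_dom S mul s \<inter> T)" for a
    using that LS(1) by (auto simp: right_dom_def)
  show ?thesis
  proof
    assume T: "minimal_left_ideal S mul T"
    \<comment> \<open>Any element of the intersection serves as witness, since membership in
      \<open>T\<close> makes \<open>T\<close> absorb every \<open>s \<bullet> a\<close> with
      \<open>s\<close> in \<open>L\<close>.\<close>
    obtain a where a: "a \<in> (\<Inter>s\<in>L. right_dom S mul s \<inter> T)" using assms(4) by blast
    have "left_ideal S mul (right_translate mul L a)"
      using left_ideal_right_translate[OF assms(1) L] dom[OF a] by blast
    moreover have "right_translate mul L a \<subseteq> T"
      using left_ideal_closed[of S mul T a] T dom[OF a] LS(2)
      by (auto simp: right_translate_def minimal_left_ideal_def)
    ultimately have "T = right_translate mul L a"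
      using T unfolding minimal_left_ideal_def by blast
    with a show "\<exists>a\<in>(\<Inter>s\<in>L. right_dom S mul s \<inter> T). T = right_translate mul L a" by blast
  next
    assume "\<exists>a\<in>(\<Inter>s\<in>L. right_dom S mul s \<inter> T). T = right_translate mul L a"
    then obtain a where a: "a \<in> (\<Inter>s\<in>L. right_dom S mul s \<inter> T)"
      and T: "T = right_translate mul L a" by blast
    show "minimal_left_ideal S mul T"
      unfolding T
      using minimal_left_ideal_right_translate[OF assms(1,2)] dom[OF a] by blast
  qed
qed

end
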